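(* Let $(\mathbf{C},\otimes,\mathbf 1)$ be a symmetric monoidal category and $(X,w:X\to\mathbf 1)$ a copointed object such that (1) for every $n$ the equaliser $(M_nX,\mathrm{eq}_n)$ of all symmetries of $X^{\otimes n}$ exists (so the draw-and-delete chain can be built), and (2) the delete chain $\mathbf 1\xleftarrow{d_0}X\xleftarrow{d_1}X^{\otimes 2}\cdots$ has a limit $(X^\omega,\pi_{\le n})$. Then the draw-and-delete chain has a limit $(L,\rho_n:L\to M_nX)$ in $\mathbf{C}$ if and only if the equaliser $L'$ of all finitely supported symmetries of $X^\omega$ exists, and in that case $L\cong L'$. If moreover both the equalisers of symmetries of the $X^{\otimes n}$ and the limit $X^\omega$ of the delete chain commute with the tensor product, then whenever the limit of one of the two diagrams (the draw-and-delete chain, resp. the family of finitely supported symmetries of $X^\omega$) commutes with the tensor product, so does the limit of the other.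
   Context: Canonical isomorphisms $Y\otimes\mathbf 1\cong Y$ are left implicit. $d_n=X^{\otimes n}\otimes w$. $\mathrm{DD}_n:M_{n+1}X\to M_nX$ is the unique morphism with $\mathrm{eq}_n\circ\mathrm{DD}_n=d_n\circ\mathrm{eq}_{n+1}$; the draw-and-delete chain is $\mathbf 1\xleftarrow{\mathrm{DD}_0}M_1X\xleftarrow{\mathrm{DD}_1}M_2X\cdots$. For a permutation $\sigma$ of $\{1,\dots,N\}$, $\dot\sigma:X^\omega\to X^\omega$ is the unique morphism with $\pi_{\le m}\circ\dot\sigma=\sigma^{\uparrow m}\circ\pi_{\le m}$ for all $m\ge N$, where $\sigma^{\uparrow m}$ is the symmetry of $X^{\otimes m}$ permuting the first $N$ factors by $\sigma$; these are the finitely supported symmetries. Commutation with the tensor product means, for every object $Y$: $(M_nX\otimes Y,\mathrm{eq}_n\otimes Y)$ is the equaliser of $\{\tau\otimes Y\}$ for $\tau$ ranging over symmetries of $X^{\otimes n}$; $(X^\omega\otimes Y,\pi_{\le n}\otimes Y)$ is a limit of the chain $(d_n\otimes Y)_n$; $(L\otimes Y,\rho_n\otimes Y)$ is a limit of the chain $(\mathrm{DD}_n\otimes Y)_n$; and $L'\otimes Y$ (with the equalising morphism tensored with $Y$) is the equaliser of $\{\dot\sigma\otimes Y\}$. *)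

theory Defs
  imports "HOL-Combinatorics.Permutations"
begin

section \<open>Categories, equalisers and limits of chains\<close>

record ('o, 'm) cat_data =
  Obj :: "'o set"
  Arr :: "'m set"
  Dom :: "'m \<Rightarrow> 'o"
  Cod :: "'m \<Rightarrow> 'o"
  Idt :: "'o \<Rightarrow> 'm"
  Comp :: "'m \<Rightarrow> 'm \<Rightarrow> 'm"  (infixr "\<cdot>\<index>" 55)

definition hom :: "('o, 'm, 'z) cat_data_scheme \<Rightarrow> 'o \<Rightarrow> 'o \<Rightarrow> 'm set" where
  "hom C a b = {f \<in> Arr C. Dom C f = a \<and> Cod C f = b}"

locale category =
  fixes C :: "('o, 'm, 'z) cat_data_scheme" (structure)
  assumes Dom_Obj: "f \<in> Arr C \<Longrightarrow> Dom C f \<in> Obj C"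
    and Cod_Obj: "f \<in> Arr C \<Longrightarrow> Cod C f \<in> Obj C"
    and Idt_hom: "a \<in> Obj C \<Longrightarrow> Idt C a \<in> hom C a a"
    and Comp_hom: "\<lbrakk>f \<in> hom C a b; g \<in> hom C b c\<rbrakk> \<Longrightarrow> g \<cdot> f \<in> hom C a c"
    and Comp_Idt: "f \<in> hom C a b \<Longrightarrow> f \<cdot> Idt C a = f"
    and Idt_Comp: "f \<in> hom C a b \<Longrightarrow> Idt C b \<cdot> f = f"
    and Comp_assoc:
      "\<lbrakk>f \<in> hom C a b; g \<in> hom C b c; h \<in> hom C c d\<rbrakk> \<Longrightarrow> (h \<cdot> g) \<cdot> f = h \<cdot> (g \<cdot> f)"

definition inverse_arrows :: "('o, 'm, 'z) cat_data_scheme \<Rightarrow> 'm \<Rightarrow> 'm \<Rightarrow> bool" where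
  "inverse_arrows C f g \<longleftrightarrow>
     f \<in> Arr C \<and> g \<in> hom C (Cod C f) (Dom C f) \<and>
     g \<cdot>\<^bsub>C\<^esub> f = Idt C (Dom C f) \<and> f \<cdot>\<^bsub>C\<^esub> g = Idt C (Cod C f)"

definition iso_arrow :: "('o, 'm, 'z) cat_data_scheme \<Rightarrow> 'm \<Rightarrow> bool" where
  "iso_arrow C f \<longleftrightarrow> (\<exists>g. inverse_arrows C f g)"

definition inv_arrow :: "('o, 'm, 'z) cat_data_scheme \<Rightarrow> 'm \<Rightarrow> 'm" where
  "inv_arrow C f = (THE g. inverse_arrows C f g)"

definition isomorphic :: "('o, 'm, 'z) cat_data_scheme \<Rightarrow> 'o \<Rightarrow> 'o \<Rightarrow> bool" where
  "isomorphic C a b \<longleftrightarrow> (\<exists>f \<in> hom C a b. iso_arrow C f)"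

text \<open>\<open>is_equaliser C F A B E e\<close>: the arrow \<open>e : E \<rightarrow> A\<close> is an equaliser of the whole set \<open>F\<close>
  of parallel arrows \<open>A \<rightarrow> B\<close>.\<close>

definition is_equaliser ::
    "('o, 'm, 'z) cat_data_scheme \<Rightarrow> 'm set \<Rightarrow> 'o \<Rightarrow> 'o \<Rightarrow> 'o \<Rightarrow> 'm \<Rightarrow> bool" where
  "is_equaliser C F A B E e \<longleftrightarrow>
     F \<subseteq> hom C A B \<and> E \<in> Obj C \<and> e \<in> hom C E A \<and>
     (\<forall>f\<in>F. \<forall>g\<in>F. f \<cdot>\<^bsub>C\<^esub> e = g \<cdot>\<^bsub>C\<^esub> e) \<and>
     (\<forall>Z h. h \<in> hom C Z A \<and> (\<forall>f\<in>F. \<forall>g\<in>F. f \<cdot>\<^bsub>C\<^esub> h = g \<cdot>\<^bsub>C\<^esub> h) \<longrightarrow>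
        (\<exists>!u. u \<in> hom C Z E \<and> e \<cdot>\<^bsub>C\<^esub> u = h))"

text \<open>Limits of chains \<open>A 0 \<leftarrow> A 1 \<leftarrow> A 2 \<leftarrow> \<dots>\<close> with \<open>a n : A (n + 1) \<rightarrow> A n\<close>.\<close>

definition is_chain_cone ::
    "('o, 'm, 'z) cat_data_scheme \<Rightarrow> (nat \<Rightarrow> 'o) \<Rightarrow> (nat \<Rightarrow> 'm) \<Rightarrow> 'o \<Rightarrow> (nat \<Rightarrow> 'm) \<Rightarrow> bool" where
  "is_chain_cone C A a Z q \<longleftrightarrow>
     Z \<in> Obj C \<and> (\<forall>n. q n \<in> hom C Z (A n)) \<and> (\<forall>n. a n \<cdot>\<^bsub>C\<^esub> q (Suc n) = q n)"

definition is_chain_limit ::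
    "('o, 'm, 'z) cat_data_scheme \<Rightarrow> (nat \<Rightarrow> 'o) \<Rightarrow> (nat \<Rightarrow> 'm) \<Rightarrow> 'o \<Rightarrow> (nat \<Rightarrow> 'm) \<Rightarrow> bool" where
  "is_chain_limit C A a L p \<longleftrightarrow>
     (\<forall>n. a n \<in> hom C (A (Suc n)) (A n)) \<and> is_chain_cone C A a L p \<and>
     (\<forall>Z q. is_chain_cone C A a Z q \<longrightarrow>
        (\<exists>!u. u \<in> hom C Z L \<and> (\<forall>n. p n \<cdot>\<^bsub>C\<^esub> u = q n)))"


section \<open>Symmetric monoidal categories\<close>

text \<open>\<open>\<otimes>\<close> is the tensor of objects and \<open>\<boxtimes>\<close> that of arrows.  The components are
  \<open>Assoc a b c : (a \<otimes> b) \<otimes> c \<rightarrow> a \<otimes> (b \<otimes> c)\<close>, \<open>Lunit a : \<one> \<otimes> a \<rightarrow> a\<close>,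
  \<open>Runit a : a \<otimes> \<one> \<rightarrow> a\<close> and \<open>Symm a b : a \<otimes> b \<rightarrow> b \<otimes> a\<close>.\<close>

record ('o, 'm) smc_data = "('o, 'm) cat_data" +
  Tensor_Obj :: "'o \<Rightarrow> 'o \<Rightarrow> 'o"  (infixl "\<otimes>\<index>" 70)
  Tensor_Arr :: "'m \<Rightarrow> 'm \<Rightarrow> 'm"  (infixl "\<boxtimes>\<index>" 70)
  Unit_Obj :: 'o  ("\<one>\<index>")
  Assoc :: "'o \<Rightarrow> 'o \<Rightarrow> 'o \<Rightarrow> 'm"
  Lunit :: "'o \<Rightarrow> 'm"
  Runit :: "'o \<Rightarrow> 'm"
  Symm :: "'o \<Rightarrow> 'o \<Rightarrow> 'm"

locale symmetric_monoidal_category = category C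
  for C :: "('o, 'm, 'z) smc_data_scheme" (structure) +
  assumes Unit_Obj: "\<one> \<in> Obj C"
    and Tensor_Obj: "\<lbrakk>a \<in> Obj C; b \<in> Obj C\<rbrakk> \<Longrightarrow> a \<otimes> b \<in> Obj C"
    and Tensor_hom:
      "\<lbrakk>f \<in> hom C a b; g \<in> hom C c d\<rbrakk> \<Longrightarrow> f \<boxtimes> g \<in> hom C (a \<otimes> c) (b \<otimes> d)"
    and Tensor_Idt: "\<lbrakk>a \<in> Obj C; b \<in> Obj C\<rbrakk> \<Longrightarrow> Idt C a \<boxtimes> Idt C b = Idt C (a \<otimes> b)"
    and Tensor_Comp:
      "\<lbrakk>f \<in> hom C a b; g \<in> hom C b c; f' \<in> hom C a' b'; g' \<in> hom C b' c'\<rbrakk> \<Longrightarrow>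
         (g \<cdot> f) \<boxtimes> (g' \<cdot> f') = (g \<boxtimes> g') \<cdot> (f \<boxtimes> f')"
    and Assoc_hom:
      "\<lbrakk>a \<in> Obj C; b \<in> Obj C; c \<in> Obj C\<rbrakk> \<Longrightarrow>
         Assoc C a b c \<in> hom C ((a \<otimes> b) \<otimes> c) (a \<otimes> (b \<otimes> c))"
    and Assoc_iso:
      "\<lbrakk>a \<in> Obj C; b \<in> Obj C; c \<in> Obj C\<rbrakk> \<Longrightarrow> iso_arrow C (Assoc C a b c)"
    and Assoc_natural:
      "\<lbrakk>f \<in> hom C a a'; g \<in> hom C b b'; h \<in> hom C c c'\<rbrakk> \<Longrightarrow>
         Assoc C a' b' c' \<cdot> ((f \<boxtimes> g) \<boxtimes> h) = (f \<boxtimes> (g \<boxtimes> h)) \<cdot> Assoc C a b c"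
    and Lunit_hom: "a \<in> Obj C \<Longrightarrow> Lunit C a \<in> hom C (\<one> \<otimes> a) a"
    and Lunit_iso: "a \<in> Obj C \<Longrightarrow> iso_arrow C (Lunit C a)"
    and Lunit_natural:
      "f \<in> hom C a b \<Longrightarrow> Lunit C b \<cdot> (Idt C \<one> \<boxtimes> f) = f \<cdot> Lunit C a"
    and Runit_hom: "a \<in> Obj C \<Longrightarrow> Runit C a \<in> hom C (a \<otimes> \<one>) a"
    and Runit_iso: "a \<in> Obj C \<Longrightarrow> iso_arrow C (Runit C a)"
    and Runit_natural:
      "f \<in> hom C a b \<Longrightarrow> Runit C b \<cdot> (f \<boxtimes> Idt C \<one>) = f \<cdot> Runit C a"
    and Symm_hom: "\<lbrakk>a \<in> Obj C; b \<in> Obj C\<rbrakk> \<Longrightarrow> Symm C a b \<in> hom C (a \<otimes> b) (b \<otimes> a)"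
    and Symm_natural:
      "\<lbrakk>f \<in> hom C a a'; g \<in> hom C b b'\<rbrakk> \<Longrightarrow>
         Symm C a' b' \<cdot> (f \<boxtimes> g) = (g \<boxtimes> f) \<cdot> Symm C a b"
    and Symm_Symm:
      "\<lbrakk>a \<in> Obj C; b \<in> Obj C\<rbrakk> \<Longrightarrow> Symm C b a \<cdot> Symm C a b = Idt C (a \<otimes> b)"
    and pentagon:
      "\<lbrakk>a \<in> Obj C; b \<in> Obj C; c \<in> Obj C; d \<in> Obj C\<rbrakk> \<Longrightarrow>
         Assoc C a b (c \<otimes> d) \<cdot> Assoc C (a \<otimes> b) c d =
         (Idt C a \<boxtimes> Assoc C b c d) \<cdot> Assoc C a (b \<otimes> c) d \<cdot> (Assoc C a b c \<boxtimes> Idt C d)"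
    and triangle:
      "\<lbrakk>a \<in> Obj C; b \<in> Obj C\<rbrakk> \<Longrightarrow>
         (Idt C a \<boxtimes> Lunit C b) \<cdot> Assoc C a \<one> b = Runit C a \<boxtimes> Idt C b"
    and hexagon:
      "\<lbrakk>a \<in> Obj C; b \<in> Obj C; c \<in> Obj C\<rbrakk> \<Longrightarrow>
         Assoc C b c a \<cdot> Symm C a (b \<otimes> c) \<cdot> Assoc C a b c =
         (Idt C b \<boxtimes> Symm C a c) \<cdot> Assoc C b a c \<cdot> (Symm C a b \<boxtimes> Idt C c)"

definition equaliser_commutes_tensor ::
    "('o, 'm, 'z) smc_data_scheme \<Rightarrow> 'm set \<Rightarrow> 'o \<Rightarrow> 'o \<Rightarrow> 'o \<Rightarrow> 'm \<Rightarrow> bool" where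
  "equaliser_commutes_tensor C F A B E e \<longleftrightarrow>
     (\<forall>Y\<in>Obj C. is_equaliser C ((\<lambda>f. f \<boxtimes>\<^bsub>C\<^esub> Idt C Y) ` F)
        (A \<otimes>\<^bsub>C\<^esub> Y) (B \<otimes>\<^bsub>C\<^esub> Y) (E \<otimes>\<^bsub>C\<^esub> Y) (e \<boxtimes>\<^bsub>C\<^esub> Idt C Y))"

definition chain_limit_commutes_tensor ::
    "('o, 'm, 'z) smc_data_scheme \<Rightarrow> (nat \<Rightarrow> 'o) \<Rightarrow> (nat \<Rightarrow> 'm) \<Rightarrow> 'o \<Rightarrow> (nat \<Rightarrow> 'm) \<Rightarrow> bool" where
  "chain_limit_commutes_tensor C A a L p \<longleftrightarrow>
     (\<forall>Y\<in>Obj C. is_chain_limit C (\<lambda>n. A n \<otimes>\<^bsub>C\<^esub> Y) (\<lambda>n. a n \<boxtimes>\<^bsub>C\<^esub> Idt C Y)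
        (L \<otimes>\<^bsub>C\<^esub> Y) (\<lambda>n. p n \<boxtimes>\<^bsub>C\<^esub> Idt C Y))"


section \<open>Tensor powers and their symmetries\<close>

primrec tpow :: "('o, 'm, 'z) smc_data_scheme \<Rightarrow> 'o \<Rightarrow> nat \<Rightarrow> 'o" where
  "tpow C X 0 = \<one>\<^bsub>C\<^esub>"
| "tpow C X (Suc n) = tpow C X n \<otimes>\<^bsub>C\<^esub> X"

text \<open>The tensor factors of \<open>tpow C X n\<close> are numbered \<open>0, \<dots>, n - 1\<close> from left to right.
  \<open>swap_last C X n\<close> exchanges the last two factors of \<open>tpow C X (n + 2)\<close>, and, for \<open>k \<le> n\<close>,
  \<open>move_last C X n k\<close> moves factor \<open>k\<close> of \<open>tpow C X (n + 1)\<close> to the last position, keeping the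
  order of the others.\<close>

definition swap_last :: "('o, 'm, 'z) smc_data_scheme \<Rightarrow> 'o \<Rightarrow> nat \<Rightarrow> 'm" where
  "swap_last C X n =
     inv_arrow C (Assoc C (tpow C X n) X X) \<cdot>\<^bsub>C\<^esub>
     (Idt C (tpow C X n) \<boxtimes>\<^bsub>C\<^esub> Symm C X X) \<cdot>\<^bsub>C\<^esub> Assoc C (tpow C X n) X X"

primrec move_last :: "('o, 'm, 'z) smc_data_scheme \<Rightarrow> 'o \<Rightarrow> nat \<Rightarrow> nat \<Rightarrow> 'm" where
  "move_last C X 0 k = Idt C (tpow C X 1)"
| "move_last C X (Suc n) k =
     (if k = Suc n then Idt C (tpow C X (Suc (Suc n)))
      else swap_last C X n \<cdot>\<^bsub>C\<^esub> (move_last C X n k \<boxtimes>\<^bsub>C\<^esub> Idt C X))"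

text \<open>For \<open>\<sigma> permutes {..<n}\<close>, \<open>perm_arrow C X n \<sigma>\<close> is the symmetry of \<open>tpow C X n\<close> carrying the
  factor in position \<open>i\<close> to position \<open>\<sigma> i\<close>: the factor \<open>k\<close> with \<open>\<sigma> k = n\<close> is first moved to the
  end, and the others are then permuted by the induced permutation of \<open>{..<n}\<close>.  By coherence,
  any other composite of structure maps inducing \<open>\<sigma>\<close> is the same arrow.  If \<open>\<sigma> permutes {..<N}\<close>
  and \<open>m \<ge> N\<close>, then \<open>\<sigma>\<close> is also a permutation of \<open>{..<m}\<close>, and \<open>perm_arrow C X m \<sigma>\<close> is the
  symmetry that permutes the first \<open>N\<close> of \<open>m\<close> factors by \<open>\<sigma>\<close>.\<close>

definition drop_perm :: "nat \<Rightarrow> (nat \<Rightarrow> nat) \<Rightarrow> nat \<Rightarrow> nat" where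
  "drop_perm n \<sigma> = (\<lambda>i. if n \<le> i then i else if i < inv \<sigma> n then \<sigma> i else \<sigma> (Suc i))"

primrec perm_arrow ::
    "('o, 'm, 'z) smc_data_scheme \<Rightarrow> 'o \<Rightarrow> nat \<Rightarrow> (nat \<Rightarrow> nat) \<Rightarrow> 'm" where
  "perm_arrow C X 0 \<sigma> = Idt C \<one>\<^bsub>C\<^esub>"
| "perm_arrow C X (Suc n) \<sigma> =
     (perm_arrow C X n (drop_perm n \<sigma>) \<boxtimes>\<^bsub>C\<^esub> Idt C X) \<cdot>\<^bsub>C\<^esub> move_last C X n (inv \<sigma> n)"

definition symmetries :: "('o, 'm, 'z) smc_data_scheme \<Rightarrow> 'o \<Rightarrow> nat \<Rightarrow> 'm set" where
  "symmetries C X n = {perm_arrow C X n \<sigma> | \<sigma>. \<sigma> permutes {..<n}}"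


section \<open>The delete and draw-and-delete chains\<close>

definition delete :: "('o, 'm, 'z) smc_data_scheme \<Rightarrow> 'o \<Rightarrow> 'm \<Rightarrow> nat \<Rightarrow> 'm" where
  "delete C X w n = Runit C (tpow C X n) \<cdot>\<^bsub>C\<^esub> (Idt C (tpow C X n) \<boxtimes>\<^bsub>C\<^esub> w)"

definition draw_delete ::
    "('o, 'm, 'z) smc_data_scheme \<Rightarrow> 'o \<Rightarrow> 'm \<Rightarrow> (nat \<Rightarrow> 'o) \<Rightarrow> (nat \<Rightarrow> 'm) \<Rightarrow> nat \<Rightarrow> 'm" where
  "draw_delete C X w M eq n =
     (THE f. f \<in> hom C (M (Suc n)) (M n) \<and>
        eq n \<cdot>\<^bsub>C\<^esub> f = delete C X w n \<cdot>\<^bsub>C\<^esub> eq (Suc n))"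

definition perm_omega ::
    "('o, 'm, 'z) smc_data_scheme \<Rightarrow> 'o \<Rightarrow> 'o \<Rightarrow> (nat \<Rightarrow> 'm) \<Rightarrow> nat \<Rightarrow> (nat \<Rightarrow> nat) \<Rightarrow> 'm" where
  "perm_omega C X X\<omega> \<pi> N \<sigma> =
     (THE h. h \<in> hom C X\<omega> X\<omega> \<and> (\<forall>m\<ge>N. \<pi> m \<cdot>\<^bsub>C\<^esub> h = perm_arrow C X m \<sigma> \<cdot>\<^bsub>C\<^esub> \<pi> m))"

definition fin_symmetries ::
    "('o, 'm, 'z) smc_data_scheme \<Rightarrow> 'o \<Rightarrow> 'o \<Rightarrow> (nat \<Rightarrow> 'm) \<Rightarrow> 'm set" where
  "fin_symmetries C X X\<omega> \<pi> = {perm_omega C X X\<omega> \<pi> N \<sigma> | N \<sigma>. \<sigma> permutes {..<N}}"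

end

(* Composing a cone (q n) over the draw-and-delete chain with the monomorphisms eq n gives a cone
   over the delete chain, i.e. an arrow h into X^omega with pi n h = eq n (q n); such an h is fixed
   by all finitely supported symmetries.  Conversely, if h is fixed by them, then pi n h equalises
   the symmetries of X^n and factors through eq n.  So the two limits represent the same functor.
   This argument uses nothing about the tensor product, and tensoring all the data with Y yields
   another instance of it, which gives the commutation statement. *)
theory Submission
  imports Defs
begin

section \<open>Equalisers and limits of chains in a plain category\<close>

context category
begin

lemma hom_Obj: "f \<in> hom C a b \<Longrightarrow> a \<in> Obj C" "f \<in> hom C a b \<Longrightarrow> b \<in> Obj C"
  using Dom_Obj Cod_Obj by (auto simp: hom_def)

lemma inverse_arrows_unique:
  assumes "inverse_arrows C f g" "inverse_arrows C f g'"
  shows "g = g'"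
proof -
  have f: "f \<in> hom C (Dom C f) (Cod C f)"
    using assms by (auto simp: inverse_arrows_def hom_def)
  have g: "g \<in> hom C (Cod C f) (Dom C f)" "g' \<in> hom C (Cod C f) (Dom C f)"
    using assms by (auto simp: inverse_arrows_def)
  have "g = g \<cdot> (f \<cdot> g')"
    using assms Comp_Idt[OF g(1)] by (simp add: inverse_arrows_def)
  also have "\<dots> = (g \<cdot> f) \<cdot> g'"
    using Comp_assoc[OF g(2) f g(1)] by simp
  also have "\<dots> = g'"
    using assms Idt_Comp[OF g(2)] by (simp add: inverse_arrows_def)
  finally show ?thesis .
qed

lemma inv_arrow_hom:
  assumes "iso_arrow C f" "f \<in> hom C a b"
  shows "inv_arrow C f \<in> hom C b a"
proof -
  obtain g where g: "inverse_arrows C f g"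
    using assms by (auto simp: iso_arrow_def)
  then have "inv_arrow C f = g"
    unfolding inv_arrow_def using inverse_arrows_unique by blast
  with g assms(2) show ?thesis
    by (auto simp: inverse_arrows_def hom_def)
qed

lemma Comp_right_cong:
  assumes "u \<in> hom C a b" "e \<in> hom C b c" "f \<in> hom C c d" "g \<in> hom C c d" "f \<cdot> e = g \<cdot> e"
  shows "f \<cdot> (e \<cdot> u) = g \<cdot> (e \<cdot> u)"
  by (simp only: Comp_assoc[OF assms(1,2,3), symmetric]
      Comp_assoc[OF assms(1,2,4), symmetric] assms(5))

lemma is_equaliserD:
  assumes "is_equaliser C F A B E e"
  shows "F \<subseteq> hom C A B" and "E \<in> Obj C" and "e \<in> hom C E A"
    and "\<And>f g. \<lbrakk>f \<in> F; g \<in> F\<rbrakk> \<Longrightarrow> f \<cdot> e = g \<cdot> e"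
    and "\<And>Z h. \<lbrakk>h \<in> hom C Z A; \<forall>f\<in>F. \<forall>g\<in>F. f \<cdot> h = g \<cdot> h\<rbrakk> \<Longrightarrow>
      \<exists>!u. u \<in> hom C Z E \<and> e \<cdot> u = h"
proof -
  note def = assms[unfolded is_equaliser_def]
  note tail = def[THEN conjunct2, THEN conjunct2, THEN conjunct2]
  show "F \<subseteq> hom C A B" "E \<in> Obj C" "e \<in> hom C E A"
    using def by iprover+
  show "f \<cdot> e = g \<cdot> e" if "f \<in> F" "g \<in> F" for f g
    by (rule bspec[OF bspec[OF tail[THEN conjunct1] that(1)] that(2)])
  show "\<exists>!u. u \<in> hom C Z E \<and> e \<cdot> u = h"
    if "h \<in> hom C Z A" "\<forall>f\<in>F. \<forall>g\<in>F. f \<cdot> h = g \<cdot> h" for Z h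
    by (rule tail[THEN conjunct2, THEN spec, THEN spec, THEN mp, OF conjI, OF that])
qed

lemma is_equaliserI:
  assumes "F \<subseteq> hom C A B" and "e \<in> hom C E A"
    and "\<And>f g. \<lbrakk>f \<in> F; g \<in> F\<rbrakk> \<Longrightarrow> f \<cdot> e = g \<cdot> e"
    and "\<And>Z h. \<lbrakk>h \<in> hom C Z A; \<forall>f\<in>F. \<forall>g\<in>F. f \<cdot> h = g \<cdot> h\<rbrakk> \<Longrightarrow>
      \<exists>!u. u \<in> hom C Z E \<and> e \<cdot> u = h"
  shows "is_equaliser C F A B E e"
  unfolding is_equaliser_def
proof (intro conjI allI impI)
  show "\<forall>f\<in>F. \<forall>g\<in>F. f \<cdot> e = g \<cdot> e"
    by (intro ballI assms(3))
qed (use assms(1,2,4) hom_Obj(1)[OF assms(2)] in blast)+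

text \<open>The arrow \<open>e \<cdot> u\<close> equalises \<open>F\<close> because \<open>e\<close>
  does, so \<open>u\<close> and \<open>v\<close> are two factorisations of one equalising arrow
  through \<open>e\<close>.\<close>

lemma is_equaliser_mono:
  assumes "is_equaliser C F A B E e"
    and "u \<in> hom C Z E" "v \<in> hom C Z E" "e \<cdot> u = e \<cdot> v"
  shows "u = v"
proof -
  have F: "F \<subseteq> hom C A B" and e: "e \<in> hom C E A"
    and eq: "\<And>f g. f \<in> F \<Longrightarrow> g \<in> F \<Longrightarrow> f \<cdot> e = g \<cdot> e"
    by (fact is_equaliserD[OF assms(1)])+
  have "f \<cdot> (e \<cdot> u) = g \<cdot> (e \<cdot> u)" if "f \<in> F" "g \<in> F" for f g
    using Comp_right_cong[OF assms(2) e] that F eq by blast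
  then have "\<exists>!x. x \<in> hom C Z E \<and> e \<cdot> x = e \<cdot> u"
    by (intro is_equaliserD(5)[OF assms(1)] Comp_hom[OF assms(2) e] ballI)
  with assms show ?thesis by metis
qed

text \<open>Projections below \<open>N\<close> are recovered from later ones by applying the chain
  maps, so agreement on a tail is agreement everywhere. The tail version is needed because a
  finitely supported symmetry is specified only at stages from its support bound on.\<close>

lemma is_chain_limit_joint_mono:
  assumes "is_chain_limit C A a L p"
    and "u \<in> hom C Z L" "v \<in> hom C Z L" "\<And>m. m \<ge> N \<Longrightarrow> p m \<cdot> u = p m \<cdot> v"
  shows "u = v"
proof -
  have a: "\<And>n. a n \<in> hom C (A (Suc n)) (A n)" and p: "\<And>n. p n \<in> hom C L (A n)"
    and ap: "\<And>n. a n \<cdot> p (Suc n) = p n"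
    using assms(1) by (auto simp: is_chain_limit_def is_chain_cone_def)
  have compose: "a n \<cdot> (p (Suc n) \<cdot> x) = p n \<cdot> x" if "x \<in> hom C Z L" for x n
    using Comp_assoc[OF that p a] ap by metis
  have all: "p n \<cdot> u = p n \<cdot> v" for n
  proof (cases "n \<le> N")
    case True
    then show ?thesis
    \<comment> \<open>Downward induction from \<open>N\<close>: stage \<open>n\<close> is
      \<open>a n\<close> applied to stage \<open>Suc n\<close>.\<close>
    proof (induction rule: inc_induct)
      case base
      show ?case using assms(4) by simp
    next
      case (step n)
      then show ?case using compose[OF assms(2)] compose[OF assms(3)] by metis
    qed
  qed (use assms(4) in simp)
  have "is_chain_cone C A a Z (\<lambda>n. p n \<cdot> u)"
    using compose assms(2) Comp_hom p hom_Obj(1) unfolding is_chain_cone_def by blast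
  then have "\<exists>!x. x \<in> hom C Z L \<and> (\<forall>n. p n \<cdot> x = p n \<cdot> u)"
    using assms(1) unfolding is_chain_limit_def by blast
  with assms(2,3) all show ?thesis by metis
qed

text \<open>Supplies the missing lower legs when a cone is only given from stage \<open>N\<close>
  on, as happens in the construction of the symmetries of \<open>X\<omega>\<close>.\<close>

lemma eventual_chain_cone_extends:
  assumes a: "\<And>n. a n \<in> hom C (A (Suc n)) (A n)" and "Z \<in> Obj C"
    and "\<And>n. n \<ge> N \<Longrightarrow> q n \<in> hom C Z (A n)"
    and "\<And>n. n \<ge> N \<Longrightarrow> a n \<cdot> q (Suc n) = q n"
  shows "\<exists>q'. is_chain_cone C A a Z q' \<and> (\<forall>n\<ge>N. q' n = q n)"
  using assms(3,4)
proof (induction N arbitrary: q)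
  case 0
  then show ?case using assms(2) by (auto simp: is_chain_cone_def)
next
  case (Suc N)
  \<comment> \<open>The cone equation at \<open>N\<close> forces this value; \<open>r\<close> then
    satisfies the assumptions one stage lower.\<close>
  define r where "r = q(N := a N \<cdot> q (Suc N))"
  have "r n \<in> hom C Z (A n)" "a n \<cdot> r (Suc n) = r n" if "n \<ge> N" for n
    using that Suc.prems Comp_hom[OF Suc.prems(1) a, of N] by (cases "n = N"; simp add: r_def)+
  from Suc.IH[OF this] obtain q' where "is_chain_cone C A a Z q'" "\<forall>n\<ge>N. q' n = r n"
    by blast
  then show ?case by (auto simp: r_def)
qed

text \<open>Each arrow factors through the other, and both round trips are identities since
  \<open>e\<close> and \<open>e'\<close> are monic. The equations with \<open>e\<close> and
  \<open>e'\<close> are kept so that they can later be tensored with an object.\<close>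

lemma is_equaliser_iso:
  assumes E: "is_equaliser C F A B E e" and E': "is_equaliser C F A B E' e'"
  shows "\<exists>u v. u \<in> hom C E E' \<and> v \<in> hom C E' E \<and> e' \<cdot> u = e \<and> e \<cdot> v = e' \<and>
    v \<cdot> u = Idt C E \<and> u \<cdot> v = Idt C E'"
proof -
  have e: "e \<in> hom C E A" "e' \<in> hom C E' A"
    by (fact is_equaliserD(3)[OF E] is_equaliserD(3)[OF E'])+
  obtain u where u: "u \<in> hom C E E'" "e' \<cdot> u = e"
    using is_equaliserD(4)[OF E] is_equaliserD(5)[OF E' e(1)] by blast
  obtain v where v: "v \<in> hom C E' E" "e \<cdot> v = e'"
    using is_equaliserD(4)[OF E'] is_equaliserD(5)[OF E e(2)] by blast
  have "v \<cdot> u = Idt C E"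
  proof (rule is_equaliser_mono[OF E])
    show "v \<cdot> u \<in> hom C E E" "Idt C E \<in> hom C E E"
      using Comp_hom u v Idt_hom hom_Obj by blast+
    show "e \<cdot> (v \<cdot> u) = e \<cdot> Idt C E"
      using Comp_assoc[OF u(1) v(1) e(1)] u v Comp_Idt[OF e(1)] by simp
  qed
  moreover have "u \<cdot> v = Idt C E'"
  proof (rule is_equaliser_mono[OF E'])
    show "u \<cdot> v \<in> hom C E' E'" "Idt C E' \<in> hom C E' E'"
      using Comp_hom u v Idt_hom hom_Obj by blast+
    show "e' \<cdot> (u \<cdot> v) = e' \<cdot> Idt C E'"
      using Comp_assoc[OF v(1) u(1) e(2)] u v Comp_Idt[OF e(2)] by simp
  qed
  ultimately show ?thesis using u v by blast
qed

text \<open>A factorisation \<open>y\<close> through \<open>e\<close> becomes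
  \<open>v \<cdot> y\<close>. The inverse pair is given explicitly because the lemma is applied to
  tensored comparison arrows, where only one of the two objects is known to be an equaliser.\<close>

lemma is_equaliser_transport:
  assumes E: "is_equaliser C F A B E e"
    and u: "u \<in> hom C E' E" and v: "v \<in> hom C E E'"
    and uv: "u \<cdot> v = Idt C E" and vu: "v \<cdot> u = Idt C E'"
  shows "is_equaliser C F A B E' (e \<cdot> u)"
proof -
  have F: "F \<subseteq> hom C A B" and e: "e \<in> hom C E A"
    and eq: "\<And>f g. f \<in> F \<Longrightarrow> g \<in> F \<Longrightarrow> f \<cdot> e = g \<cdot> e"
    by (fact is_equaliserD[OF E])+
  have "\<exists>!x. x \<in> hom C Z E' \<and> (e \<cdot> u) \<cdot> x = h"
    if h: "h \<in> hom C Z A" "\<forall>f\<in>F. \<forall>g\<in>F. f \<cdot> h = g \<cdot> h" for Z h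
  proof -
    obtain y where y: "y \<in> hom C Z E" "e \<cdot> y = h"
      using is_equaliserD(5)[OF E h] by blast
    have "u \<cdot> (v \<cdot> y) = y"
      using Comp_assoc[OF y(1) v u] uv Idt_Comp[OF y(1)] by simp
    then have "v \<cdot> y \<in> hom C Z E' \<and> (e \<cdot> u) \<cdot> (v \<cdot> y) = h"
      using Comp_assoc[OF Comp_hom[OF y(1) v] u e] y(2) Comp_hom[OF y(1) v] by simp
    moreover have "x = v \<cdot> y" if x: "x \<in> hom C Z E'" "(e \<cdot> u) \<cdot> x = h" for x
    proof -
      have "u \<cdot> x = y"
        using is_equaliser_mono[OF E Comp_hom[OF x(1) u] y(1)] Comp_assoc[OF x(1) u e] x(2) y(2)
        by simp
      then show ?thesis
        using Comp_assoc[OF x(1) u v] vu Idt_Comp[OF x(1)] by simp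
    qed
    ultimately show ?thesis by blast
  qed
  moreover have "f \<cdot> (e \<cdot> u) = g \<cdot> (e \<cdot> u)" if "f \<in> F" "g \<in> F" for f g
    using Comp_right_cong[OF u e] that F eq by blast
  ultimately show ?thesis
    using F Comp_hom[OF u e] by (intro is_equaliserI)
qed

end

section \<open>Chains with symmetries\<close>

text \<open>\<open>s n \<sigma>\<close> abstracts the symmetry of \<open>X\<^sup>n\<close> (or of \<open>X\<^sup>n \<otimes> Y\<close>) given by \<open>\<sigma>\<close>, and \<open>t N \<sigma>\<close>
  the one induced on the limit \<open>W\<close>.\<close>

locale symmetric_chain = category C
  for C :: "('o, 'm, 'z) cat_data_scheme" (structure) +
  fixes A :: "nat \<Rightarrow> 'o" and a :: "nat \<Rightarrow> 'm" and W :: 'o and \<pi> :: "nat \<Rightarrow> 'm"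
    and s t :: "nat \<Rightarrow> (nat \<Rightarrow> nat) \<Rightarrow> 'm"
    and M :: "nat \<Rightarrow> 'o" and eq DD :: "nat \<Rightarrow> 'm"
  assumes limit: "is_chain_limit C A a W \<pi>"
    and s_id: "s n id = Idt C (A n)"
    and equaliser: "is_equaliser C {s n \<sigma> |\<sigma>. \<sigma> permutes {..<n}} (A n) (A n) (M n) (eq n)"
    and DD_hom: "DD n \<in> hom C (M (Suc n)) (M n)"
    and eq_DD: "eq n \<cdot> DD n = a n \<cdot> eq (Suc n)"
    and t_hom: "\<sigma> permutes {..<N} \<Longrightarrow> t N \<sigma> \<in> hom C W W"
    and \<pi>_t: "\<lbrakk>\<sigma> permutes {..<N}; N \<le> m\<rbrakk> \<Longrightarrow> \<pi> m \<cdot> t N \<sigma> = s m \<sigma> \<cdot> \<pi> m"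
begin

text \<open>This relation is the bijection between the two represented functors: \<open>h\<close>
  and \<open>q\<close> determine each other because the \<open>\<pi> n\<close> are jointly monic and
  every \<open>eq n\<close> is monic. That \<open>q\<close> is a cone and \<open>h\<close> is fixed
  by all \<open>t N \<sigma>\<close> are consequences, proved below.\<close>

definition compatible :: "'o \<Rightarrow> 'm \<Rightarrow> (nat \<Rightarrow> 'm) \<Rightarrow> bool" where
  "compatible Z h q \<longleftrightarrow>
     h \<in> hom C Z W \<and> (\<forall>n. q n \<in> hom C Z (M n) \<and> \<pi> n \<cdot> h = eq n \<cdot> q n)"

lemma a_hom: "a n \<in> hom C (A (Suc n)) (A n)"
  and \<pi>_hom: "\<pi> n \<in> hom C W (A n)"
  and a_\<pi>: "a n \<cdot> \<pi> (Suc n) = \<pi> n"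
  using limit by (auto simp: is_chain_limit_def is_chain_cone_def)

lemma eq_hom: "eq n \<in> hom C (M n) (A n)"
  by (rule is_equaliserD(3)[OF equaliser])

lemma s_hom: "\<sigma> permutes {..<n} \<Longrightarrow> s n \<sigma> \<in> hom C (A n) (A n)"
  using is_equaliserD(1)[OF equaliser] by blast

text \<open>The identity permutation is one of the equalised symmetries, so being equalised by all
  of them amounts to being fixed by each.\<close>

lemma s_eq:
  assumes "\<sigma> permutes {..<n}"
  shows "s n \<sigma> \<cdot> eq n = eq n"
proof -
  have "s n \<sigma> \<cdot> eq n = s n id \<cdot> eq n"
    by (rule is_equaliserD(4)[OF equaliser]) (use assms permutes_id[of "{..<n}"] in blast)+
  then show ?thesis using Idt_Comp[OF eq_hom] s_id by simp
qed

lemma permutes_mono: "\<sigma> permutes {..<N} \<Longrightarrow> N \<le> m \<Longrightarrow> \<sigma> permutes {..<m::nat}"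
  by (erule permutes_subset) auto

text \<open>Since \<open>eq n\<close> is monic, the cone equation may be checked after composing
  with it; there both sides become \<open>\<pi> n \<cdot> h\<close>.\<close>

lemma compatible_cone:
  assumes "compatible Z h q"
  shows "is_chain_cone C M DD Z q"
proof -
  have h: "h \<in> hom C Z W" and q: "\<And>n. q n \<in> hom C Z (M n)" and hq: "\<And>n. \<pi> n \<cdot> h = eq n \<cdot> q n"
    using assms by (auto simp: compatible_def)
  have "DD n \<cdot> q (Suc n) = q n" for n
  proof (rule is_equaliser_mono[OF equaliser])
    show "DD n \<cdot> q (Suc n) \<in> hom C Z (M n)" "q n \<in> hom C Z (M n)"
      using Comp_hom q DD_hom by blast+
    have "eq n \<cdot> (DD n \<cdot> q (Suc n)) = (eq n \<cdot> DD n) \<cdot> q (Suc n)"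
      using Comp_assoc[OF q DD_hom eq_hom] by simp
    also have "\<dots> = a n \<cdot> (eq (Suc n) \<cdot> q (Suc n))"
      unfolding eq_DD using Comp_assoc[OF q eq_hom a_hom] by simp
    also have "\<dots> = a n \<cdot> (\<pi> (Suc n) \<cdot> h)"
      using hq by simp
    also have "\<dots> = \<pi> n \<cdot> h"
      using Comp_assoc[OF h \<pi>_hom a_hom[of n]] a_\<pi>[of n] by simp
    finally show "eq n \<cdot> (DD n \<cdot> q (Suc n)) = eq n \<cdot> q n"
      using hq by simp
  qed
  then show ?thesis
    using q hom_Obj(1)[OF h] by (auto simp: is_chain_cone_def)
qed

text \<open>It suffices to compare projections to stages \<open>m \<ge> N\<close>. There
  \<open>t N \<sigma>\<close> acts as \<open>s m \<sigma>\<close>, which \<open>eq m\<close> absorbs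
  because \<open>\<sigma>\<close> also permutes \<open>{..<m}\<close>.\<close>

lemma compatible_fixed:
  assumes "compatible Z h q" "\<sigma> permutes {..<N}"
  shows "t N \<sigma> \<cdot> h = h"
proof (rule is_chain_limit_joint_mono[OF limit])
  have h: "h \<in> hom C Z W" and q: "\<And>n. q n \<in> hom C Z (M n)" and hq: "\<And>n. \<pi> n \<cdot> h = eq n \<cdot> q n"
    using assms(1) by (auto simp: compatible_def)
  show "t N \<sigma> \<cdot> h \<in> hom C Z W" "h \<in> hom C Z W"
    using h Comp_hom[OF h t_hom[OF assms(2)]] by auto
  fix m assume m: "m \<ge> N"
  note \<sigma> = permutes_mono[OF assms(2) m]
  have "\<pi> m \<cdot> (t N \<sigma> \<cdot> h) = (s m \<sigma> \<cdot> \<pi> m) \<cdot> h"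
    using Comp_assoc[OF h t_hom[OF assms(2)] \<pi>_hom[of m]] \<pi>_t[OF assms(2) m] by simp
  also have "\<dots> = s m \<sigma> \<cdot> (eq m \<cdot> q m)"
    using Comp_assoc[OF h \<pi>_hom s_hom[OF \<sigma>]] hq by simp
  also have "\<dots> = eq m \<cdot> q m"
    using Comp_assoc[OF q eq_hom s_hom[OF \<sigma>]] s_eq[OF \<sigma>] by simp
  finally show "\<pi> m \<cdot> (t N \<sigma> \<cdot> h) = \<pi> m \<cdot> h"
    using hq by simp
qed

text \<open>By \<open>eq_DD\<close>, the arrows \<open>eq n \<cdot> q n\<close> form a cone over the
  chain \<open>a\<close>, and \<open>h\<close> is the arrow that the limit \<open>W\<close> induces
  from it.\<close>

lemma cone_ex_compatible:
  assumes "is_chain_cone C M DD Z q"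
  shows "\<exists>h. compatible Z h q"
proof -
  have Z: "Z \<in> Obj C" and q: "\<And>n. q n \<in> hom C Z (M n)" and DDq: "\<And>n. DD n \<cdot> q (Suc n) = q n"
    using assms by (auto simp: is_chain_cone_def)
  have "a n \<cdot> (eq (Suc n) \<cdot> q (Suc n)) = eq n \<cdot> q n" for n
    using Comp_assoc[OF q eq_hom a_hom] Comp_assoc[OF q DD_hom eq_hom] eq_DD DDq by metis
  then have "is_chain_cone C A a Z (\<lambda>n. eq n \<cdot> q n)"
    using Z Comp_hom[OF q eq_hom] by (auto simp: is_chain_cone_def)
  then obtain h where "h \<in> hom C Z W" "\<forall>n. \<pi> n \<cdot> h = eq n \<cdot> q n"
    using limit unfolding is_chain_limit_def by blast
  then show ?thesis using q by (auto simp: compatible_def)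
qed

text \<open>Plays the same role for \<open>W\<close> as \<open>s_id\<close> for the finite stages:
  it turns equalising all the \<open>t N \<sigma>\<close> into being fixed by each.\<close>

lemma t_id: "t N id = Idt C W"
proof (rule is_chain_limit_joint_mono[OF limit])
  show "t N id \<in> hom C W W" "Idt C W \<in> hom C W W"
    using t_hom permutes_id Idt_hom hom_Obj(1)[OF \<pi>_hom] by auto
  show "\<pi> m \<cdot> t N id = \<pi> m \<cdot> Idt C W" if "m \<ge> N" for m
    using \<pi>_t[OF permutes_id that] s_id Idt_Comp[OF \<pi>_hom] Comp_Idt[OF \<pi>_hom] by simp
qed

lemma equalising_ex_compatible:
  assumes h: "h \<in> hom C Z W"
    and eqs: "\<forall>f\<in>{t N \<sigma> |N \<sigma>. \<sigma> permutes {..<N}}. \<forall>g\<in>{t N \<sigma> |N \<sigma>. \<sigma> permutes {..<N}}.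
      f \<cdot> h = g \<cdot> h"
  shows "\<exists>q. compatible Z h q"
proof -
  have th: "t N \<sigma> \<cdot> h = h" if "\<sigma> permutes {..<N}" for N \<sigma>
  proof -
    have "t N \<sigma> \<cdot> h = t N id \<cdot> h"
      using eqs that permutes_id[of "{..<N}"] by blast
    then show ?thesis using t_id Idt_Comp[OF h] by simp
  qed
  \<comment> \<open>Every symmetry of stage \<open>n\<close> comes from one of \<open>W\<close>:
    \<open>\<pi>_t\<close> is used with both \<open>N\<close> and \<open>m\<close> equal to
    \<open>n\<close>.\<close>
  have fixed: "s n \<sigma> \<cdot> (\<pi> n \<cdot> h) = \<pi> n \<cdot> h" if \<sigma>: "\<sigma> permutes {..<n}" for n \<sigma>
    using Comp_assoc[OF h \<pi>_hom s_hom[OF \<sigma>]] Comp_assoc[OF h t_hom[OF \<sigma>] \<pi>_hom[of n]]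
      \<pi>_t[OF \<sigma> order_refl] th[OF \<sigma>] by simp
  have "\<exists>x. x \<in> hom C Z (M n) \<and> eq n \<cdot> x = \<pi> n \<cdot> h" for n
  proof -
    have "\<forall>f\<in>{s n \<sigma> |\<sigma>. \<sigma> permutes {..<n}}. \<forall>g\<in>{s n \<sigma> |\<sigma>. \<sigma> permutes {..<n}}.
        f \<cdot> (\<pi> n \<cdot> h) = g \<cdot> (\<pi> n \<cdot> h)"
      using fixed by auto
    then show ?thesis
      using is_equaliserD(5)[OF equaliser Comp_hom[OF h \<pi>_hom]] by blast
  qed
  then obtain q where "\<And>n. q n \<in> hom C Z (M n) \<and> eq n \<cdot> q n = \<pi> n \<cdot> h"
    by metis
  then show ?thesis using h unfolding compatible_def by metis
qed

text \<open>Both conditions can be read off from \<open>\<pi> n \<cdot> (e \<cdot> u) = eq n \<cdot>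
  (\<rho> n \<cdot> u)\<close>: cancelling the monic \<open>eq n\<close> gives one direction, joint
  monicity of the \<open>\<pi> n\<close> the other. Hence the two universal properties ask for the
  same \<open>u\<close>.\<close>

lemma compatible_factor_iff:
  assumes L: "compatible L e \<rho>" and Z: "compatible Z h q" and u: "u \<in> hom C Z L"
  shows "e \<cdot> u = h \<longleftrightarrow> (\<forall>n. \<rho> n \<cdot> u = q n)"
proof -
  have e: "e \<in> hom C L W" and \<rho>: "\<And>n. \<rho> n \<in> hom C L (M n)"
    and e\<rho>: "\<And>n. \<pi> n \<cdot> e = eq n \<cdot> \<rho> n"
    using L by (auto simp: compatible_def)
  have h: "h \<in> hom C Z W" and q: "\<And>n. q n \<in> hom C Z (M n)" and hq: "\<And>n. \<pi> n \<cdot> h = eq n \<cdot> q n"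
    using Z by (auto simp: compatible_def)
  have key: "\<pi> n \<cdot> (e \<cdot> u) = eq n \<cdot> (\<rho> n \<cdot> u)" for n
    using Comp_assoc[OF u e \<pi>_hom] Comp_assoc[OF u \<rho> eq_hom] e\<rho> by metis
  show ?thesis
  proof
    assume "e \<cdot> u = h"
    then show "\<forall>n. \<rho> n \<cdot> u = q n"
      using is_equaliser_mono[OF equaliser Comp_hom[OF u \<rho>] q] key hq by metis
  next
    assume "\<forall>n. \<rho> n \<cdot> u = q n"
    then show "e \<cdot> u = h"
      using is_chain_limit_joint_mono[OF limit Comp_hom[OF u e] h] key hq by metis
  qed
qed

text \<open>A test arrow for the equaliser has a compatible cone and a cone has a compatible arrow,
  and \<open>compatible_factor_iff\<close> identifies their factorisations. So each universal
  property yields the other on the same object \<open>L\<close>.\<close>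

lemma limit_iff_equaliser:
  assumes L: "compatible L e \<rho>"
  shows "is_chain_limit C M DD L \<rho> \<longleftrightarrow>
    is_equaliser C {t N \<sigma> |N \<sigma>. \<sigma> permutes {..<N}} W W L e" (is "?lim \<longleftrightarrow> ?equ")
proof
  assume lim: ?lim
  have "\<exists>!u. u \<in> hom C Z L \<and> e \<cdot> u = h"
    if h: "h \<in> hom C Z W" "\<forall>f\<in>{t N \<sigma> |N \<sigma>. \<sigma> permutes {..<N}}.
      \<forall>g\<in>{t N \<sigma> |N \<sigma>. \<sigma> permutes {..<N}}. f \<cdot> h = g \<cdot> h" for Z h
  proof -
    obtain q where q: "compatible Z h q"
      using equalising_ex_compatible[OF h] by blast
    have "\<exists>!u. u \<in> hom C Z L \<and> (\<forall>n. \<rho> n \<cdot> u = q n)"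
      using lim compatible_cone[OF q] unfolding is_chain_limit_def by blast
    then show ?thesis using compatible_factor_iff[OF L q] by (metis (no_types, lifting))
  qed
  moreover have "\<forall>f\<in>{t N \<sigma> |N \<sigma>. \<sigma> permutes {..<N}}.
      \<forall>g\<in>{t N \<sigma> |N \<sigma>. \<sigma> permutes {..<N}}. f \<cdot> e = g \<cdot> e"
    using compatible_fixed[OF L] by auto
  moreover have "e \<in> hom C L W"
    using L by (simp add: compatible_def)
  ultimately show ?equ
    using t_hom by (intro is_equaliserI) blast+
next
  assume equ: ?equ
  have "\<exists>!u. u \<in> hom C Z L \<and> (\<forall>n. \<rho> n \<cdot> u = q n)" if cone: "is_chain_cone C M DD Z q" for Z q
  proof -
    obtain h where h: "compatible Z h q"
      using cone_ex_compatible[OF cone] by blast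
    have "\<forall>f\<in>{t N \<sigma> |N \<sigma>. \<sigma> permutes {..<N}}.
        \<forall>g\<in>{t N \<sigma> |N \<sigma>. \<sigma> permutes {..<N}}. f \<cdot> h = g \<cdot> h"
      using compatible_fixed[OF h] by auto
    moreover have "h \<in> hom C Z W"
      using h by (simp add: compatible_def)
    ultimately have "\<exists>!u. u \<in> hom C Z L \<and> e \<cdot> u = h"
      using is_equaliserD(5)[OF equ] by blast
    then show ?thesis using compatible_factor_iff[OF L h] by (metis (no_types, lifting))
  qed
  then show ?lim
    using DD_hom compatible_cone[OF L] by (auto simp: is_chain_limit_def)
qed

end

section \<open>Symmetries of tensor powers and of the infinite power\<close>

context symmetric_monoidal_category
begin

lemma tpow_Obj: "X \<in> Obj C \<Longrightarrow> tpow C X n \<in> Obj C"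
  by (induction n) (auto simp: Unit_Obj Tensor_Obj)

lemma swap_last_hom:
  assumes X: "X \<in> Obj C"
  shows "swap_last C X n \<in> hom C (tpow C X (Suc (Suc n))) (tpow C X (Suc (Suc n)))"
proof -
  note T = tpow_Obj[OF X, of n]
  have "Idt C (tpow C X n) \<boxtimes> Symm C X X
      \<in> hom C (tpow C X n \<otimes> (X \<otimes> X)) (tpow C X n \<otimes> (X \<otimes> X))"
    using Tensor_hom Idt_hom[OF T] Symm_hom[OF X X] by blast
  then show ?thesis
    using Comp_hom[OF Comp_hom[OF Assoc_hom[OF T X X]]
        inv_arrow_hom[OF Assoc_iso[OF T X X] Assoc_hom[OF T X X]]]
    by (simp add: swap_last_def)
qed

lemma move_last_hom:
  assumes X: "X \<in> Obj C"
  shows "move_last C X n k \<in> hom C (tpow C X (Suc n)) (tpow C X (Suc n))"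
proof (induction n)
  case 0
  then show ?case using Idt_hom[OF tpow_Obj[OF X, of 1]] by simp
next
  case (Suc n)
  then have "move_last C X n k \<boxtimes> Idt C X
      \<in> hom C (tpow C X (Suc (Suc n))) (tpow C X (Suc (Suc n)))"
    using Tensor_hom[OF Suc Idt_hom[OF X]] by simp
  from Comp_hom[OF this swap_last_hom[OF X]] show ?case
    using Idt_hom[OF tpow_Obj[OF X, of "Suc (Suc n)"]] by simp
qed

lemma perm_arrow_hom:
  assumes X: "X \<in> Obj C"
  shows "perm_arrow C X n \<sigma> \<in> hom C (tpow C X n) (tpow C X n)"
\<comment> \<open>The recursion passes from \<open>\<sigma>\<close> to
  \<open>drop_perm n \<sigma>\<close>, so \<open>\<sigma>\<close> has to vary.\<close>
proof (induction n arbitrary: \<sigma>)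
  case 0
  then show ?case using Idt_hom[OF Unit_Obj] by simp
next
  case (Suc n)
  show ?case
    using Comp_hom[OF move_last_hom[OF X]] Tensor_hom[OF Suc Idt_hom[OF X]] by simp
qed

text \<open>Here \<open>\<sigma>\<close> fixes \<open>n\<close>, so the factor to be moved to the
  end is already there and dropping it leaves \<open>\<sigma>\<close> unchanged.\<close>

lemma perm_arrow_Suc_fixed:
  assumes X: "X \<in> Obj C" and \<sigma>: "\<sigma> permutes {..<n}"
  shows "perm_arrow C X (Suc n) \<sigma> = perm_arrow C X n \<sigma> \<boxtimes> Idt C X"
proof -
  have inv: "inv \<sigma> n = n"
    using permutes_not_in[OF permutes_inv[OF \<sigma>]] by simp
  then have "drop_perm n \<sigma> = \<sigma>"
    using permutes_not_in[OF \<sigma>] by (auto simp: drop_perm_def fun_eq_iff)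
  moreover have "move_last C X n n = Idt C (tpow C X (Suc n))"
    by (cases n) auto
  ultimately show ?thesis
    using inv Comp_Idt[OF Tensor_hom[OF perm_arrow_hom[OF X] Idt_hom[OF X]]] by simp
qed

lemma perm_arrow_id:
  assumes X: "X \<in> Obj C"
  shows "perm_arrow C X n id = Idt C (tpow C X n)"
proof (induction n)
  case (Suc n)
  then show ?case
    using perm_arrow_Suc_fixed[OF X permutes_id] Tensor_Idt[OF tpow_Obj[OF X] X]
    by (metis tpow.simps(2))
qed simp

section \<open>Deletion against symmetries, and the arrows induced on the equalisers and on the
  infinite power\<close>

lemma delete_hom:
  assumes X: "X \<in> Obj C" and w: "w \<in> hom C X \<one>"
  shows "delete C X w n \<in> hom C (tpow C X (Suc n)) (tpow C X n)"
  unfolding delete_def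
  using Comp_hom[OF Tensor_hom[OF Idt_hom[OF tpow_Obj[OF X]] w] Runit_hom[OF tpow_Obj[OF X]]]
  by simp

text \<open>By the interchange law \<open>f\<close> and \<open>w\<close> act on different factors
  and so commute; naturality of \<open>Runit\<close> then moves \<open>f\<close> past the
  unitor.\<close>

lemma delete_natural:
  assumes X: "X \<in> Obj C" and w: "w \<in> hom C X \<one>" and f: "f \<in> hom C (tpow C X n) (tpow C X n)"
  shows "delete C X w n \<cdot> (f \<boxtimes> Idt C X) = f \<cdot> delete C X w n"
proof -
  let ?I = "Idt C (tpow C X n)" and ?R = "Runit C (tpow C X n)"
  note T = tpow_Obj[OF X, of n]
  note I = Idt_hom[OF T] and R = Runit_hom[OF T]
  note fX = Tensor_hom[OF f Idt_hom[OF X]] and Iw = Tensor_hom[OF I w]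
    and fI = Tensor_hom[OF f Idt_hom[OF Unit_Obj]]
  have "(?I \<boxtimes> w) \<cdot> (f \<boxtimes> Idt C X) = (?I \<cdot> f) \<boxtimes> (w \<cdot> Idt C X)"
    using Tensor_Comp[OF f I Idt_hom[OF X] w] by simp
  also have "\<dots> = (f \<cdot> ?I) \<boxtimes> (Idt C \<one> \<cdot> w)"
    using Idt_Comp[OF f] Comp_Idt[OF f] Idt_Comp[OF w] Comp_Idt[OF w] by simp
  also have "\<dots> = (f \<boxtimes> Idt C \<one>) \<cdot> (?I \<boxtimes> w)"
    using Tensor_Comp[OF I f w Idt_hom[OF Unit_Obj]] by simp
  finally have "delete C X w n \<cdot> (f \<boxtimes> Idt C X) = ?R \<cdot> ((f \<boxtimes> Idt C \<one>) \<cdot> (?I \<boxtimes> w))"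
    unfolding delete_def using Comp_assoc[OF fX Iw R] by simp
  also have "\<dots> = (f \<cdot> ?R) \<cdot> (?I \<boxtimes> w)"
    using Comp_assoc[OF Iw fI R] Runit_natural[OF f] by simp
  also have "\<dots> = f \<cdot> delete C X w n"
    unfolding delete_def using Comp_assoc[OF Iw R f] by simp
  finally show ?thesis .
qed

lemma delete_perm_arrow:
  assumes "X \<in> Obj C" "w \<in> hom C X \<one>" "\<sigma> permutes {..<n}"
  shows "delete C X w n \<cdot> perm_arrow C X (Suc n) \<sigma> = perm_arrow C X n \<sigma> \<cdot> delete C X w n"
  using delete_natural[OF assms(1,2) perm_arrow_hom[OF assms(1)]]
  unfolding perm_arrow_Suc_fixed[OF assms(1,3)] .

text \<open>Makes the definite description in \<open>draw_delete\<close> meaningful. A symmetry of n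
  factors passes through the deletion as a symmetry of n + 1 factors fixing the last one, and
  \<open>eq (Suc n)\<close> equalises those; hence the composite factors uniquely through
  \<open>eq n\<close>.\<close>

lemma draw_delete:
  assumes X: "X \<in> Obj C" and w: "w \<in> hom C X \<one>"
    and E: "\<And>n. is_equaliser C (symmetries C X n) (tpow C X n) (tpow C X n) (M n) (eq n)"
  shows "draw_delete C X w M eq n \<in> hom C (M (Suc n)) (M n)" (is ?hom)
    and "eq n \<cdot> draw_delete C X w M eq n = delete C X w n \<cdot> eq (Suc n)" (is ?eq)
proof -
  let ?d = "delete C X w n"
  have eq: "eq (Suc n) \<in> hom C (M (Suc n)) (tpow C X (Suc n))"
    by (rule is_equaliserD(3)[OF E])
  note d = delete_hom[OF X w, of n]
  have move: "perm_arrow C X n \<sigma> \<cdot> (?d \<cdot> eq (Suc n)) =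
      ?d \<cdot> (perm_arrow C X (Suc n) \<sigma> \<cdot> eq (Suc n))" if "\<sigma> permutes {..<n}" for \<sigma>
    using Comp_assoc[OF eq d perm_arrow_hom[OF X, of n \<sigma>]]
      Comp_assoc[OF eq perm_arrow_hom[OF X, of _ \<sigma>] d]
      delete_perm_arrow[OF X w that] by (simp del: perm_arrow.simps)
  have "perm_arrow C X n \<sigma> \<cdot> (?d \<cdot> eq (Suc n)) = perm_arrow C X n \<tau> \<cdot> (?d \<cdot> eq (Suc n))"
    if "\<sigma> permutes {..<n}" "\<tau> permutes {..<n}" for \<sigma> \<tau>
  proof -
    have "\<sigma> permutes {..<Suc n}" "\<tau> permutes {..<Suc n}"
      using that by (auto elim: permutes_subset)
    then have "perm_arrow C X (Suc n) \<sigma> \<cdot> eq (Suc n) = perm_arrow C X (Suc n) \<tau> \<cdot> eq (Suc n)"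
      by (intro is_equaliserD(4)[OF E]) (auto simp: symmetries_def)
    then show ?thesis
      by (simp only: move that)
  qed
  then have "\<forall>f\<in>symmetries C X n. \<forall>g\<in>symmetries C X n.
      f \<cdot> (?d \<cdot> eq (Suc n)) = g \<cdot> (?d \<cdot> eq (Suc n))"
    unfolding symmetries_def by blast
  then have "\<exists>!f. f \<in> hom C (M (Suc n)) (M n) \<and> eq n \<cdot> f = ?d \<cdot> eq (Suc n)"
    by (rule is_equaliserD(5)[OF E Comp_hom[OF eq d]])
  from theI'[OF this] show ?hom ?eq
    unfolding draw_delete_def by auto
qed

text \<open>Justifies the definite description in \<open>perm_omega\<close>: permuting the first
  \<open>N\<close> factors commutes with deleting a factor at position \<open>N\<close> or later, so
  the permuted projections form a cone from stage \<open>N\<close> on.\<close>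

lemma perm_omega:
  assumes X: "X \<in> Obj C" and w: "w \<in> hom C X \<one>"
    and lim: "is_chain_limit C (tpow C X) (delete C X w) X\<omega> \<pi>" and \<sigma>: "\<sigma> permutes {..<N}"
  shows "perm_omega C X X\<omega> \<pi> N \<sigma> \<in> hom C X\<omega> X\<omega>" (is ?hom)
    and "N \<le> m \<Longrightarrow> \<pi> m \<cdot> perm_omega C X X\<omega> \<pi> N \<sigma> = perm_arrow C X m \<sigma> \<cdot> \<pi> m"
      (is "_ \<Longrightarrow> ?eq")
proof -
  have \<pi>: "\<pi> n \<in> hom C X\<omega> (tpow C X n)" and d\<pi>: "delete C X w n \<cdot> \<pi> (Suc n) = \<pi> n" for n
    using lim by (auto simp: is_chain_limit_def is_chain_cone_def)
  note d = delete_hom[OF X w] and P = perm_arrow_hom[OF X]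
  have "delete C X w n \<cdot> (perm_arrow C X (Suc n) \<sigma> \<cdot> \<pi> (Suc n)) = perm_arrow C X n \<sigma> \<cdot> \<pi> n"
    if "n \<ge> N" for n
  proof -
    have "\<sigma> permutes {..<n}"
      using \<sigma> that by (auto elim: permutes_subset)
    then show ?thesis
      using Comp_assoc[OF \<pi> P d] Comp_assoc[OF \<pi> d P] delete_perm_arrow[OF X w] d\<pi> by metis
  qed
  then obtain q where q: "is_chain_cone C (tpow C X) (delete C X w) X\<omega> q"
      "\<forall>n\<ge>N. q n = perm_arrow C X n \<sigma> \<cdot> \<pi> n"
    using eventual_chain_cone_extends[of "delete C X w" "tpow C X" X\<omega> N
        "\<lambda>n. perm_arrow C X n \<sigma> \<cdot> \<pi> n"] d hom_Obj(1)[OF \<pi>] Comp_hom[OF \<pi> P] by blast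
  obtain h where h: "h \<in> hom C X\<omega> X\<omega>" "\<forall>n. \<pi> n \<cdot> h = q n"
    using lim q(1) unfolding is_chain_limit_def by blast
  have "\<exists>!h. h \<in> hom C X\<omega> X\<omega> \<and> (\<forall>m\<ge>N. \<pi> m \<cdot> h = perm_arrow C X m \<sigma> \<cdot> \<pi> m)"
  proof (rule ex1I[of _ h])
    show "h \<in> hom C X\<omega> X\<omega> \<and> (\<forall>m\<ge>N. \<pi> m \<cdot> h = perm_arrow C X m \<sigma> \<cdot> \<pi> m)"
      using h q(2) by simp
    fix k assume k: "k \<in> hom C X\<omega> X\<omega> \<and> (\<forall>m\<ge>N. \<pi> m \<cdot> k = perm_arrow C X m \<sigma> \<cdot> \<pi> m)"
    show "k = h"
      by (rule is_chain_limit_joint_mono[OF lim, where N = N]) (use k h q(2) in auto)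
  qed
  from theI'[OF this] show ?hom "N \<le> m \<Longrightarrow> ?eq"
    unfolding perm_omega_def by auto
qed

text \<open>Functoriality of tensoring with \<open>Y\<close>, which carries the equations of the
  chain data over to the tensored data.\<close>

lemma Tensor_Comp_Idt:
  assumes "Y \<in> Obj C" "f \<in> hom C a b" "g \<in> hom C b c"
  shows "(g \<boxtimes> Idt C Y) \<cdot> (f \<boxtimes> Idt C Y) = (g \<cdot> f) \<boxtimes> Idt C Y"
  using Tensor_Comp[OF assms(2,3) Idt_hom Idt_hom] Comp_Idt[OF Idt_hom] assms(1) by metis

end

section \<open>The theorem, from the abstract setting applied once directly and once after tensoring
  with each object\<close>

theorem theorem2p15:
  fixes C :: "('o, 'm, 'z) smc_data_scheme"
    and X X\<omega> :: 'o and w :: 'm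
    and M :: "nat \<Rightarrow> 'o" and eq \<pi> :: "nat \<Rightarrow> 'm"
  assumes smc: "symmetric_monoidal_category C"
    and copointed: "X \<in> Obj C" "w \<in> hom C X \<one>\<^bsub>C\<^esub>"
    and equalisers:
      "\<And>n. is_equaliser C (symmetries C X n) (tpow C X n) (tpow C X n) (M n) (eq n)"
    and delete_limit: "is_chain_limit C (tpow C X) (delete C X w) X\<omega> \<pi>"
  defines "DD \<equiv> draw_delete C X w M eq"
    and "\<Sigma> \<equiv> fin_symmetries C X X\<omega> \<pi>"
  shows "((\<exists>L \<rho>. is_chain_limit C M DD L \<rho>) \<longleftrightarrow> (\<exists>L' e. is_equaliser C \<Sigma> X\<omega> X\<omega> L' e)) \<and>
    (\<forall>L \<rho> L' e. is_chain_limit C M DD L \<rho> \<and> is_equaliser C \<Sigma> X\<omega> X\<omega> L' e \<longrightarrow>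
       isomorphic C L L') \<and>
    ((\<forall>n. equaliser_commutes_tensor C (symmetries C X n) (tpow C X n) (tpow C X n) (M n) (eq n)) \<and>
     chain_limit_commutes_tensor C (tpow C X) (delete C X w) X\<omega> \<pi> \<longrightarrow>
       (\<forall>L \<rho> L' e. is_chain_limit C M DD L \<rho> \<and> is_equaliser C \<Sigma> X\<omega> X\<omega> L' e \<longrightarrow>
          (chain_limit_commutes_tensor C M DD L \<rho> \<longleftrightarrow>
           equaliser_commutes_tensor C \<Sigma> X\<omega> X\<omega> L' e)))"
proof -
  interpret symmetric_monoidal_category C by (rule smc)
  note X = copointed(1) and w = copointed(2)
  let ?s = "perm_arrow C X" and ?t = "perm_omega C X X\<omega> \<pi>"
  have \<Sigma>: "\<Sigma> = {?t N \<sigma> |N \<sigma>. \<sigma> permutes {..<N}}"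
    by (simp add: \<Sigma>_def fin_symmetries_def)
  note DD = draw_delete[OF X w equalisers, folded DD_def]
  interpret S: symmetric_chain C "tpow C X" "delete C X w" X\<omega> \<pi> ?s ?t M eq DD
    by unfold_locales (rule delete_limit perm_arrow_id[OF X] equalisers[unfolded symmetries_def] DD
        perm_omega[OF X w delete_limit]; assumption?)+
  have limD: "\<exists>e. S.compatible L e \<rho> \<and> is_equaliser C \<Sigma> X\<omega> X\<omega> L e"
    if lim: "is_chain_limit C M DD L \<rho>" for L \<rho>
  proof -
    obtain e where "S.compatible L e \<rho>"
      using S.cone_ex_compatible[of L \<rho>] lim unfolding is_chain_limit_def by blast
    then show ?thesis
      using S.limit_iff_equaliser lim unfolding \<Sigma> by blast
  qed
  have "\<exists>\<rho>. is_chain_limit C M DD L' \<rho>" if "is_equaliser C \<Sigma> X\<omega> X\<omega> L' e" for L' e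
  proof -
    note equ = that[unfolded \<Sigma>]
    \<comment> \<open>An equaliser arrow is itself a test arrow, so its compatible family exists and
      serves as the limit cone on \<open>L'\<close>.\<close>
    have "\<exists>\<rho>. S.compatible L' e \<rho>"
      by (rule S.equalising_ex_compatible[OF is_equaliserD(3)[OF equ]])
        (intro ballI is_equaliserD(4)[OF equ])
    then show ?thesis using S.limit_iff_equaliser equ by blast
  qed
  with limD have ex: "(\<exists>L \<rho>. is_chain_limit C M DD L \<rho>) \<longleftrightarrow> (\<exists>L' e. is_equaliser C \<Sigma> X\<omega> X\<omega> L' e)"
    by blast
  have iso: "isomorphic C L L'"
    if lim: "is_chain_limit C M DD L \<rho>" and equ: "is_equaliser C \<Sigma> X\<omega> X\<omega> L' e" for L \<rho> L' e
  proof -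
    obtain e1 where "is_equaliser C \<Sigma> X\<omega> X\<omega> L e1"
      using limD[OF lim] by blast
    from is_equaliser_iso[OF this equ] obtain u v where "u \<in> hom C L L'" "v \<in> hom C L' L"
        "v \<cdot>\<^bsub>C\<^esub> u = Idt C L" "u \<cdot>\<^bsub>C\<^esub> v = Idt C L'"
      by blast
    moreover from this have "inverse_arrows C u v"
      by (auto simp: inverse_arrows_def hom_def)
    ultimately show ?thesis
      by (auto simp: isomorphic_def iso_arrow_def)
  qed
  have commute: "chain_limit_commutes_tensor C M DD L \<rho> \<longleftrightarrow>
      equaliser_commutes_tensor C \<Sigma> X\<omega> X\<omega> L' e"
    if ec: "\<forall>n. equaliser_commutes_tensor C (symmetries C X n) (tpow C X n) (tpow C X n) (M n) (eq n)"
      and lc: "chain_limit_commutes_tensor C (tpow C X) (delete C X w) X\<omega> \<pi>"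
      and lim: "is_chain_limit C M DD L \<rho>" and equ: "is_equaliser C \<Sigma> X\<omega> X\<omega> L' e" for L \<rho> L' e
  proof -
    \<comment> \<open>The given equaliser \<open>(L', e)\<close> may differ from the equaliser
      \<open>(L, e1)\<close> determined by \<open>\<rho>\<close>; the arrows \<open>u\<close> and
      \<open>v\<close> obtained next compare them.\<close>
    obtain e1 where e1: "S.compatible L e1 \<rho>" and equ1: "is_equaliser C \<Sigma> X\<omega> X\<omega> L e1"
      using limD[OF lim] by blast
    obtain u v where u: "u \<in> hom C L L'" and v: "v \<in> hom C L' L"
      and eu: "e \<cdot>\<^bsub>C\<^esub> u = e1" "e1 \<cdot>\<^bsub>C\<^esub> v = e"
      and vu: "v \<cdot>\<^bsub>C\<^esub> u = Idt C L" "u \<cdot>\<^bsub>C\<^esub> v = Idt C L'"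
      using is_equaliser_iso[OF equ1 equ] by blast
    have e: "e \<in> hom C L' X\<omega>" "e1 \<in> hom C L X\<omega>"
      by (fact is_equaliserD(3)[OF equ] is_equaliserD(3)[OF equ1])+
    have \<rho>: "\<rho> n \<in> hom C L (M n)" and e\<rho>: "\<pi> n \<cdot>\<^bsub>C\<^esub> e1 = eq n \<cdot>\<^bsub>C\<^esub> \<rho> n" for n
      using e1 by (auto simp: S.compatible_def)
    have L: "L \<in> Obj C" "L' \<in> Obj C"
      using u hom_Obj by auto
    have "is_chain_limit C (\<lambda>n. M n \<otimes>\<^bsub>C\<^esub> Y) (\<lambda>n. DD n \<boxtimes>\<^bsub>C\<^esub> Idt C Y) (L \<otimes>\<^bsub>C\<^esub> Y)
          (\<lambda>n. \<rho> n \<boxtimes>\<^bsub>C\<^esub> Idt C Y) \<longleftrightarrow>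
        is_equaliser C ((\<lambda>f. f \<boxtimes>\<^bsub>C\<^esub> Idt C Y) ` \<Sigma>) (X\<omega> \<otimes>\<^bsub>C\<^esub> Y) (X\<omega> \<otimes>\<^bsub>C\<^esub> Y) (L' \<otimes>\<^bsub>C\<^esub> Y)
          (e \<boxtimes>\<^bsub>C\<^esub> Idt C Y)" if Y: "Y \<in> Obj C" for Y
    proof -
      let ?T = "\<lambda>f. f \<boxtimes>\<^bsub>C\<^esub> Idt C Y"
      note TC = Tensor_Comp_Idt[OF Y] and TH = Tensor_hom[OF _ Idt_hom[OF Y]]
      have image: "{?T (?s n \<sigma>) |\<sigma>. \<sigma> permutes {..<n}} = ?T ` symmetries C X n"
        "{?T (?t N \<sigma>) |N \<sigma>. \<sigma> permutes {..<N}} = ?T ` \<Sigma>" for n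
        by (auto simp: \<Sigma> symmetries_def)
      \<comment> \<open>The hypotheses \<open>lc\<close> and \<open>ec\<close> supply the limit and
        the equalisers. The arrows \<open>DD\<close> and \<open>t\<close> are the old ones tensored
        with \<open>Y\<close>, so their equations follow from functoriality.\<close>
      interpret SY: symmetric_chain C "\<lambda>n. tpow C X n \<otimes>\<^bsub>C\<^esub> Y" "\<lambda>n. ?T (delete C X w n)"
        "X\<omega> \<otimes>\<^bsub>C\<^esub> Y" "\<lambda>n. ?T (\<pi> n)" "\<lambda>n \<sigma>. ?T (?s n \<sigma>)" "\<lambda>N \<sigma>. ?T (?t N \<sigma>)"
        "\<lambda>n. M n \<otimes>\<^bsub>C\<^esub> Y" "\<lambda>n. ?T (eq n)" "\<lambda>n. ?T (DD n)"
      proof unfold_locales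
        show "is_chain_limit C (\<lambda>n. tpow C X n \<otimes>\<^bsub>C\<^esub> Y) (\<lambda>n. ?T (delete C X w n))
            (X\<omega> \<otimes>\<^bsub>C\<^esub> Y) (\<lambda>n. ?T (\<pi> n))"
          using lc Y by (simp add: chain_limit_commutes_tensor_def)
        show "?T (?s n id) = Idt C (tpow C X n \<otimes>\<^bsub>C\<^esub> Y)" for n
          using perm_arrow_id[OF X] Tensor_Idt[OF tpow_Obj[OF X] Y] by simp
        show "is_equaliser C {?T (?s n \<sigma>) |\<sigma>. \<sigma> permutes {..<n}} (tpow C X n \<otimes>\<^bsub>C\<^esub> Y)
            (tpow C X n \<otimes>\<^bsub>C\<^esub> Y) (M n \<otimes>\<^bsub>C\<^esub> Y) (?T (eq n))" for n
          unfolding image using ec Y by (simp add: equaliser_commutes_tensor_def)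
        show "?T (DD n) \<in> hom C (M (Suc n) \<otimes>\<^bsub>C\<^esub> Y) (M n \<otimes>\<^bsub>C\<^esub> Y)" for n
          by (rule TH[OF DD(1)])
        show "?T (eq n) \<cdot>\<^bsub>C\<^esub> ?T (DD n) = ?T (delete C X w n) \<cdot>\<^bsub>C\<^esub> ?T (eq (Suc n))" for n
          using TC[OF DD(1) S.eq_hom] TC[OF S.eq_hom S.a_hom] DD(2) by simp
        show "?T (?t N \<sigma>) \<in> hom C (X\<omega> \<otimes>\<^bsub>C\<^esub> Y) (X\<omega> \<otimes>\<^bsub>C\<^esub> Y)" if "\<sigma> permutes {..<N}" for \<sigma> N
          by (rule TH[OF S.t_hom[OF that]])
        show "?T (\<pi> m) \<cdot>\<^bsub>C\<^esub> ?T (?t N \<sigma>) = ?T (?s m \<sigma>) \<cdot>\<^bsub>C\<^esub> ?T (\<pi> m)"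
          if "\<sigma> permutes {..<N}" "N \<le> m" for \<sigma> N m
          using TC[OF S.t_hom[OF that(1)] S.\<pi>_hom] TC[OF S.\<pi>_hom perm_arrow_hom[OF X]]
            S.\<pi>_t[OF that] by simp
      qed
      have "SY.compatible (L \<otimes>\<^bsub>C\<^esub> Y) (?T e1) (\<lambda>n. ?T (\<rho> n))"
        unfolding SY.compatible_def
        using TH[OF e(2)] TH[OF \<rho>] TC[OF e(2) S.\<pi>_hom] TC[OF \<rho> S.eq_hom] e\<rho> by simp
      from SY.limit_iff_equaliser[OF this, unfolded image]
      have "is_chain_limit C (\<lambda>n. M n \<otimes>\<^bsub>C\<^esub> Y) (\<lambda>n. ?T (DD n)) (L \<otimes>\<^bsub>C\<^esub> Y) (\<lambda>n. ?T (\<rho> n)) \<longleftrightarrow>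
          is_equaliser C (?T ` \<Sigma>) (X\<omega> \<otimes>\<^bsub>C\<^esub> Y) (X\<omega> \<otimes>\<^bsub>C\<^esub> Y) (L \<otimes>\<^bsub>C\<^esub> Y) (?T e1)" .
      \<comment> \<open>So far the equivalence concerns \<open>?T e1\<close>. The tensored
        isomorphism carries the equaliser property between \<open>?T e1\<close> and
        \<open>?T e\<close> in both directions.\<close>
      moreover have inverse: "?T u \<cdot>\<^bsub>C\<^esub> ?T v = Idt C (L' \<otimes>\<^bsub>C\<^esub> Y)"
          "?T v \<cdot>\<^bsub>C\<^esub> ?T u = Idt C (L \<otimes>\<^bsub>C\<^esub> Y)"
        using TC[OF u v] TC[OF v u] vu Tensor_Idt L Y by simp_all
      moreover have "?T e \<cdot>\<^bsub>C\<^esub> ?T u = ?T e1" "?T e1 \<cdot>\<^bsub>C\<^esub> ?T v = ?T e"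
        using TC[OF u e(1)] TC[OF v e(2)] eu by simp_all
      ultimately show ?thesis
        using is_equaliser_transport[OF _ TH[OF u] TH[OF v] inverse]
          is_equaliser_transport[OF _ TH[OF v] TH[OF u] inverse(2,1)] by metis
    qed
    then show ?thesis
      by (simp add: chain_limit_commutes_tensor_def equaliser_commutes_tensor_def)
  qed
  from ex iso commute show ?thesis by blast
qed

end
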